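(* Let $J:\ell^2(\mathbb{Z})^m\to\ell^2(\mathbb{Z})^m$ be the self-adjoint matrix-valued Jacobi operator $(Jy)_n=a_ny_{n+1}+b_ny_n+a_{n-1}^*y_{n-1}$, $n\in\mathbb{Z}$, where $a_n$ and $b_n=b_n^*$ are $p$-periodic sequences of complex $m\times m$ matrices. Without loss of generality (after a shift of the index $n$ and, if necessary, replacing the period $p$ by a multiple of it) assume that $\min_n\mathrm{Tr}\,(a_na_n^* )^{1/2}=\mathrm{Tr}\,(a_0a_0^* )^{1/2}$ and $p\ge3$. Put $N=pm$. For $x\in[0,2\pi]$ let $K(x)=K_0+K_1(x)$ be the Hermitian $N\times N$ matrix, written in $p\times p$ blocks of size $m\times m$, where $K_0$ is the block tridiagonal matrix with diagonal blocks $b_1,\dots,b_p$, block $a_j$ in position $(j,j+1)$ and block $a_j^*$ in position $(j+1,j)$ for $1\le j\le p-1$, and all other blocks zero, and where $K_1(x)$ has block $e^{-ix}a_0^*$ in position $(1,p)$, block $e^{ix}a_0$ in position $(p,1)$, and all other blocks zero. Let $|K_1|=(K_1(x)K_1(x)^* )^{1/2}$, which is the block diagonal matrix with diagonal blocks $(a_0^*a_0)^{1/2},0,\dots,0,(a_0a_0^* )^{1/2}$ and does not depend on $x$. Let $\lambda_1(x)\le\dots\le\lambda_N(x)$ be the eigenvalues of $K(x)$ and let $\lambda_1^{\pm}\le\dots\le\lambda_N^{\pm}$ be the eigenvalues of $K_0\pm|K_1|$. Then for every $n=1,\dots,N$, $$\lambda_n^-\le\lambda_n(x)\le\lambda_n^+,\qquad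 x\in[0,2\pi].$$
   Context: For a positive semidefinite matrix $A$, $A^{1/2}$ denotes its positive semidefinite square root; $^*$ denotes the conjugate transpose; eigenvalues are counted with multiplicity. The operator $J$ is unitarily equivalent to the direct integral $\int_{[0,2\pi)}^{\oplus}K(x)\,dx$ acting in $\int_{[0,2\pi)}^{\oplus}\mathbb{C}^{pm}\,dx$, and its spectrum is $\sigma(J)=\bigcup_{x\in[0,2\pi]}\sigma(K(x))$. The spectral bands of $J$ are the ranges of the functions $\lambda_n(x)$, so the inequality is an estimate of the spectral bands. *)

theory Defs
  imports
    "HOL-Analysis.Infinite_Sum"
    "Jordan_Normal_Form.Char_Poly"
    "Jordan_Normal_Form.Schur_Decomposition"
begin


definition hermitian_mat :: "complex mat \<Rightarrow> bool" where
  "hermitian_mat A \<longleftrightarrow> square_mat A \<and> mat_adjoint A = A"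

definition psd_mat :: "complex mat \<Rightarrow> bool" where
  "psd_mat A \<longleftrightarrow> hermitian_mat A \<and>
     (\<forall>v \<in> carrier_vec (dim_row A). 0 \<le> Re ((A *\<^sub>v v) \<bullet>c v))"

text \<open>The unique positive semidefinite square root; meaningful for positive semidefinite \<open>A\<close>.\<close>

definition psd_sqrt :: "complex mat \<Rightarrow> complex mat" where
  "psd_sqrt A = (THE B. B \<in> carrier_mat (dim_row A) (dim_row A) \<and> psd_mat B \<and> B * B = A)"

text \<open>The absolute value used here is \<open>(A A\<^sup>*)\<^sup>1\<^sup>/\<^sup>2\<close>, not \<open>(A\<^sup>* A)\<^sup>1\<^sup>/\<^sup>2\<close>.\<close>

definition mat_abs :: "complex mat \<Rightarrow> complex mat" where
  "mat_abs A = psd_sqrt (A * mat_adjoint A)"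

definition mat_trace :: "complex mat \<Rightarrow> complex" where
  "mat_trace A = (\<Sum>i<dim_row A. A $$ (i, i))"

text \<open>
  The \<open>n\<close>-th smallest eigenvalue, counted with multiplicity from \<open>n = 1\<close>. It is only used for
  Hermitian matrices, whose characteristic polynomials have only real roots, so that \<open>Re\<close> merely
  changes the type, and for which algebraic and geometric multiplicities coincide.
\<close>

definition nth_eigenvalue :: "complex mat \<Rightarrow> nat \<Rightarrow> real" where
  "nth_eigenvalue A n = sorted_list_of_multiset (image_mset Re (proots (char_poly A))) ! (n - 1)"

definition ell2 :: "nat \<Rightarrow> (int \<Rightarrow> complex vec) set" where
  "ell2 m = {y. (\<forall>n. y n \<in> carrier_vec m) \<and>
                (\<lambda>n. \<Sum>i<m. (cmod (y n $ i))\<^sup>2) summable_on UNIV}"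

definition jacobi_op ::
  "(int \<Rightarrow> complex mat) \<Rightarrow> (int \<Rightarrow> complex mat) \<Rightarrow> (int \<Rightarrow> complex vec) \<Rightarrow> int \<Rightarrow> complex vec" where
  "jacobi_op a b y n =
     a n *\<^sub>v y (n + 1) + b n *\<^sub>v y n + mat_adjoint (a (n - 1)) *\<^sub>v y (n - 1)"

text \<open>
  The matrix of \<open>p \<times> p\<close> blocks of size \<open>m \<times> m\<close> whose block in position \<open>(i, j)\<close> is \<open>B i j\<close>. Blocks
  are numbered from 1, matrix entries from 0.
\<close>

definition block_matrix :: "nat \<Rightarrow> nat \<Rightarrow> (nat \<Rightarrow> nat \<Rightarrow> complex mat) \<Rightarrow> complex mat" where
  "block_matrix p m B =
     mat (p * m) (p * m) (\<lambda>(r, c). B (r div m + 1) (c div m + 1) $$ (r mod m, c mod m))"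

definition K0 ::
  "nat \<Rightarrow> nat \<Rightarrow> (int \<Rightarrow> complex mat) \<Rightarrow> (int \<Rightarrow> complex mat) \<Rightarrow> complex mat" where
  "K0 p m a b = block_matrix p m (\<lambda>i j.
     if i = j then b (int i)
     else if j = i + 1 then a (int i)
     else if i = j + 1 then mat_adjoint (a (int j))
     else 0\<^sub>m m m)"

definition K1 :: "nat \<Rightarrow> nat \<Rightarrow> (int \<Rightarrow> complex mat) \<Rightarrow> real \<Rightarrow> complex mat" where
  "K1 p m a x = block_matrix p m (\<lambda>i j.
     if i = 1 \<and> j = p then exp (- \<i> * complex_of_real x) \<cdot>\<^sub>m mat_adjoint (a 0)
     else if i = p \<and> j = 1 then exp (\<i> * complex_of_real x) \<cdot>\<^sub>m a 0
     else 0\<^sub>m m m)"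

definition K ::
  "nat \<Rightarrow> nat \<Rightarrow> (int \<Rightarrow> complex mat) \<Rightarrow> (int \<Rightarrow> complex mat) \<Rightarrow> real \<Rightarrow> complex mat" where
  "K p m a b x = K0 p m a b + K1 p m a x"

end

theory Submission
  imports Defs
begin

text \<open>
  The estimate is an operator inequality followed by monotonicity of eigenvalues. A Hermitian matrix
  \<open>T\<close> satisfies \<open>- |T| \<le> T \<le> |T|\<close> as a quadratic form (lemma \<open>mat_abs_bounds\<close>). With \<open>T = K\<^sub>1(x)\<close>
  this gives \<open>K\<^sub>0 - |K\<^sub>1| \<le> K(x) \<le> K\<^sub>0 + |K\<^sub>1|\<close>, and the \<open>n\<close>-th eigenvalue is monotone in the
  quadratic form (lemma \<open>nth_eigenvalue_mono\<close>). The blocks matter here only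
  for checking that \<open>K\<^sub>0\<close> and \<open>K\<^sub>1(x)\<close> are Hermitian.

  Both steps rest on the spectral theorem with the eigenvalues in increasing order (lemma
  \<open>hermitian_spectral\<close>), which also links the diagonal of the diagonalisation with the sorted roots
  of the characteristic polynomial.

  The explicit form of \<open>|K\<^sub>1|\<close> is a matter of recognising a square root. Since \<open>K\<^sub>1(x)\<close> only has
  blocks in the two off-diagonal corners, with opposite phases, \<open>K\<^sub>1(x)\<^sup>2\<close> is block diagonal with
  corners \<open>a\<^sub>0\<^sup>* a\<^sub>0\<close> and \<open>a\<^sub>0 a\<^sub>0\<^sup>*\<close>. The block diagonal matrix of their square roots is positive
  semidefinite, and it is the absolute value because a positive semidefinite square root is unique
  (lemma \<open>psd_root_unique\<close>).
\<close>

section \<open>The adjoint and the sesquilinear form\<close>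

text \<open>With a single dimension the simplifier discharges the premises by itself; for rectangular factors
  it would have to guess the inner dimension.\<close>

lemma square_mult_carrier [simp]:
  "A \<in> carrier_mat n n \<Longrightarrow> B \<in> carrier_mat n n \<Longrightarrow> A * B \<in> carrier_mat n n"
  by (rule mult_carrier_mat)

lemma square_mult_vec_carrier [simp]:
  "A \<in> carrier_mat n n \<Longrightarrow> v \<in> carrier_vec n \<Longrightarrow> A *\<^sub>v v \<in> carrier_vec n"
  by (rule mult_mat_vec_carrier)

lemma mat_adjoint_dim [simp]:
  "dim_row (mat_adjoint A) = dim_col A" "dim_col (mat_adjoint A) = dim_row A"
  by (auto simp: mat_adjoint_def)

lemma mat_adjoint_carrier [simp]:
  "A \<in> carrier_mat n k \<Longrightarrow> mat_adjoint A \<in> carrier_mat k n"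
  by (auto simp: mat_adjoint_def)

lemma mat_adjoint_index [simp]:
  assumes "i < dim_col A" "j < dim_row A"
  shows "mat_adjoint A $$ (i, j) = conjugate (A $$ (j, i))"
  using assms by (auto simp: mat_adjoint_def mat_of_rows_def)

lemma mat_adjoint_adjoint [simp]: "mat_adjoint (mat_adjoint A) = (A :: complex mat)"
  by (rule eq_matI) auto

lemma mat_adjoint_mult:
  fixes A B :: "complex mat"
  assumes "A \<in> carrier_mat n k" "B \<in> carrier_mat k l"
  shows "mat_adjoint (A * B) = mat_adjoint B * mat_adjoint A"
  by (rule eq_matI) (use assms in \<open>auto simp: scalar_prod_def mult.commute intro!: sum.cong\<close>)

lemma mat_adjoint_conj:
  fixes A U :: "complex mat"
  assumes "U \<in> carrier_mat n n" "A \<in> carrier_mat n n"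
  shows "mat_adjoint (U * A * mat_adjoint U) = U * mat_adjoint A * mat_adjoint U"
  using assms by (simp add: mat_adjoint_mult[of "U * A" n n "mat_adjoint U" n]
      mat_adjoint_mult[of U n n A n] assoc_mult_mat[of U n n "mat_adjoint A" n "mat_adjoint U" n])

lemma mat_adjoint_add:
  fixes A B :: "complex mat"
  assumes "A \<in> carrier_mat n k" "B \<in> carrier_mat n k"
  shows "mat_adjoint (A + B) = mat_adjoint A + mat_adjoint B"
  by (rule eq_matI) (use assms in auto)

lemma mat_adjoint_minus:
  fixes A B :: "complex mat"
  assumes "A \<in> carrier_mat n k" "B \<in> carrier_mat n k"
  shows "mat_adjoint (A - B) = mat_adjoint A - mat_adjoint B"
  by (rule eq_matI) (use assms in auto)

lemma mat_adjoint_smult: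
  fixes A :: "complex mat"
  shows "mat_adjoint (c \<cdot>\<^sub>m A) = cnj c \<cdot>\<^sub>m mat_adjoint A"
  by (rule eq_matI) auto

lemma mat_adjoint_zero [simp]: "mat_adjoint (0\<^sub>m n k :: complex mat) = 0\<^sub>m k n"
  by (rule eq_matI) auto

lemma mat_adjoint_one [simp]: "mat_adjoint (1\<^sub>m n :: complex mat) = 1\<^sub>m n"
  by (rule eq_matI) auto

lemma mat_adjoint_mat_diag:
  "mat_adjoint (mat_diag n f :: complex mat) = mat_diag n (\<lambda>i. cnj (f i))"
  by (rule eq_matI) (auto simp: mat_diag_def)

lemma cscalar_prod_adjoint:
  fixes A :: "complex mat"
  assumes A: "A \<in> carrier_mat n k" and v: "v \<in> carrier_vec k" and w: "w \<in> carrier_vec n"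
  shows "(A *\<^sub>v v) \<bullet>c w = v \<bullet>c (mat_adjoint A *\<^sub>v w)"
proof -
  have "(A *\<^sub>v v) \<bullet>c w = (\<Sum>i<n. \<Sum>j<k. A $$ (i, j) * v $ j * cnj (w $ i))"
    using assms by (auto simp: scalar_prod_def atLeast0LessThan sum_distrib_right)
  also have "\<dots> = (\<Sum>j<k. \<Sum>i<n. A $$ (i, j) * v $ j * cnj (w $ i))"
    by (rule sum.swap)
  also have "\<dots> = v \<bullet>c (mat_adjoint A *\<^sub>v w)"
    using assms by (auto simp: scalar_prod_def atLeast0LessThan sum_distrib_left mult_ac
        intro!: sum.cong)
  finally show ?thesis .
qed

lemma cscalar_prod_self:
  fixes v :: "complex vec"
  assumes "v \<in> carrier_vec n"
  shows "v \<bullet>c v = complex_of_real (\<Sum>i<n. (cmod (v $ i))\<^sup>2)"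
  using assms by (auto simp: scalar_prod_def atLeast0LessThan complex_norm_square
      simp del: of_real_power intro!: sum.cong)

section \<open>Unitary matrices\<close>

definition unitary_mat :: "nat \<Rightarrow> complex mat \<Rightarrow> bool" where
  "unitary_mat n U \<longleftrightarrow>
     U \<in> carrier_mat n n \<and> mat_adjoint U * U = 1\<^sub>m n \<and> U * mat_adjoint U = 1\<^sub>m n"

lemma unitary_matI:
  assumes "U \<in> carrier_mat n n" "mat_adjoint U * U = 1\<^sub>m n"
  shows "unitary_mat n U"
  using assms mat_mult_left_right_inverse[of "mat_adjoint U" n U] by (auto simp: unitary_mat_def)

lemma unitary_mat_mult:
  assumes U: "unitary_mat n U" and V: "unitary_mat n V"
  shows "unitary_mat n (U * V)"
proof (rule unitary_matI)
  have [simp]: "U \<in> carrier_mat n n" "V \<in> carrier_mat n n"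
    using assms by (auto simp: unitary_mat_def)
  show "U * V \<in> carrier_mat n n" by simp
  have "mat_adjoint (U * V) * (U * V) = mat_adjoint V * (mat_adjoint U * U) * V"
    by (simp add: mat_adjoint_mult[of U n n V n] assoc_mult_mat[of _ n n _ n _ n])
  also have "\<dots> = 1\<^sub>m n"
    using U V by (simp add: unitary_mat_def right_mult_one_mat[of _ n n])
  finally show "mat_adjoint (U * V) * (U * V) = 1\<^sub>m n" .
qed

lemma unitary_mat_adjoint: "unitary_mat n U \<Longrightarrow> unitary_mat n (mat_adjoint U)"
  by (auto simp: unitary_mat_def)

lemma unitary_conj_swap:
  assumes U: "unitary_mat n U" and A: "A \<in> carrier_mat n n"
    and B: "mat_adjoint U * A * U = B"
  shows "A = U * B * mat_adjoint U"
proof -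
  have [simp]: "U \<in> carrier_mat n n" "A \<in> carrier_mat n n"
    using U A by (auto simp: unitary_mat_def)
  have "U * B * mat_adjoint U = (U * mat_adjoint U) * A * (U * mat_adjoint U)"
    unfolding B[symmetric] by (simp add: assoc_mult_mat[of _ n n _ n _ n])
  also have "\<dots> = A"
    using U by (simp add: unitary_mat_def left_mult_one_mat[of _ n n] right_mult_one_mat[of _ n n])
  finally show ?thesis ..
qed

lemma char_poly_unitary_conj:
  assumes U: "unitary_mat n U" and B: "B \<in> carrier_mat n n"
  shows "char_poly (U * B * mat_adjoint U) = char_poly B"
proof (rule char_poly_similar, rule similar_matI)
  show "{U * B * mat_adjoint U, B, U, mat_adjoint U} \<subseteq> carrier_mat n n"
    "U * mat_adjoint U = 1\<^sub>m n" "mat_adjoint U * U = 1\<^sub>m n"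
    using U B by (auto simp: unitary_mat_def)
qed simp

lemma unitary_norm:
  assumes U: "unitary_mat n U" and v: "v \<in> carrier_vec n"
  shows "(\<Sum>i<n. (cmod ((U *\<^sub>v v) $ i))\<^sup>2) = (\<Sum>i<n. (cmod (v $ i))\<^sup>2)"
proof -
  have [simp]: "U \<in> carrier_mat n n" using U by (auto simp: unitary_mat_def)
  have "(U *\<^sub>v v) \<bullet>c (U *\<^sub>v v) = v \<bullet>c (mat_adjoint U *\<^sub>v (U *\<^sub>v v))"
    using v by (intro cscalar_prod_adjoint[of _ n n]) auto
  also have "mat_adjoint U *\<^sub>v (U *\<^sub>v v) = v"
    using U v by (simp add: unitary_mat_def assoc_mult_mat_vec[of _ n n _ n, symmetric])
  finally show ?thesis
    using v cscalar_prod_self[of "U *\<^sub>v v" n] cscalar_prod_self[of v n] by (simp del: of_real_sum)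
qed

text \<open>Complete \<open>v\<close> to a basis, orthogonalise by Gram-Schmidt, which leaves the first vector alone, and
  normalise the columns.\<close>

lemma unitary_first_column:
  assumes v: "v \<in> carrier_vec n" and v0: "v \<noteq> 0\<^sub>v n"
  obtains W c where "unitary_mat n W" "col W 0 = c \<cdot>\<^sub>v v"
proof -
  interpret cof_vec_space n "TYPE(complex)" .
  note b = basis_completion[OF v v0]
  define ws where "ws = gram_schmidt n (basis_completion v)"
  note gs = gram_schmidt_result[OF b(2) b(4) b(5) ws_def]
  have n: "n \<noteq> 0" using v v0 by (intro notI) (auto simp: vec_eq_iff)
  have len: "length ws = n" using gs b(6) by simp
  have wsc: "ws ! i \<in> carrier_vec n" if "i < n" for i
    using subsetD[OF gs(3) nth_mem[of i ws]] len that by simp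
  obtain vs where "basis_completion v = v # vs"
    using b(6,7) n by (cases "basis_completion v") auto
  then have "hd ws = v" using gram_schmidt_hd[OF v] by (simp add: ws_def)
  then have ws0: "ws ! 0 = v" using n len by (cases ws) auto
  define s where "s i = complex_of_real (1 / sqrt (\<Sum>k<n. (cmod (ws ! i $ k))\<^sup>2))" for i
  define W where "W = mat_of_cols n (map (\<lambda>i. s i \<cdot>\<^sub>v ws ! i) [0..<n])"
  have W: "W \<in> carrier_mat n n" using mat_of_cols_carrier(1)[of n "map (\<lambda>i. s i \<cdot>\<^sub>v ws ! i) [0..<n]"] by (simp add: W_def)
  have colW: "col W i = s i \<cdot>\<^sub>v ws ! i" if "i < n" for i
    unfolding W_def using that wsc[OF that] by (subst col_mat_of_cols) auto
  have "mat_adjoint W * W = 1\<^sub>m n"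
  proof (rule eq_matI)
    fix i j assume ij: "i < dim_row (1\<^sub>m n :: complex mat)" "j < dim_col (1\<^sub>m n :: complex mat)"
    then have ij: "i < n" "j < n" by auto
    have "(mat_adjoint W * W) $$ (i, j) = col W j \<bullet>c col W i"
      using ij W by (auto simp: scalar_prod_def mult.commute intro!: sum.cong)
    also have "\<dots> = s j * cnj (s i) * (ws ! j \<bullet>c ws ! i)"
      using ij wsc[of i] wsc[of j]
      by (auto simp: colW scalar_prod_def sum_distrib_left mult_ac intro!: sum.cong)
    also have "\<dots> = (if i = j then 1 else 0)"
    proof (cases "i = j")
      case False
      then show ?thesis using corthogonalD[OF gs(2), of j i] ij len by simp
    next
      case True
      let ?r = "\<Sum>k<n. (cmod (ws ! i $ k))\<^sup>2"
      have "ws ! i \<bullet>c ws ! i \<noteq> 0" using corthogonalD[OF gs(2), of i i] ij len by simp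
      then have r0: "?r \<noteq> 0" by (simp add: cscalar_prod_self[OF wsc[OF ij(1)]] del: of_real_sum)
      moreover have "?r \<ge> 0" by (intro sum_nonneg) auto
      ultimately have "1 / sqrt ?r * (1 / sqrt ?r) * ?r = 1"
        by (simp add: field_simps)
      then have "complex_of_real (1 / sqrt ?r * (1 / sqrt ?r) * ?r) = 1" by (simp only: of_real_1)
      moreover have "s j * cnj (s i) * (ws ! j \<bullet>c ws ! i)
          = complex_of_real (1 / sqrt ?r * (1 / sqrt ?r) * ?r)"
        unfolding True[symmetric] cscalar_prod_self[OF wsc[OF ij(1)]] s_def by (simp only: of_real_mult complex_cnj_complex_of_real)
      ultimately show ?thesis using True by simp
    qed
    finally show "(mat_adjoint W * W) $$ (i, j) = 1\<^sub>m n $$ (i, j)" using ij by simp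
  qed (use W in auto)
  then have "unitary_mat n W" by (rule unitary_matI[OF W])
  moreover have "col W 0 = s 0 \<cdot>\<^sub>v v" using colW[of 0] n ws0 by simp
  ultimately show ?thesis by (rule that)
qed

section \<open>The spectral theorem\<close>

lemma four_block_diag_adjoint:
  fixes A D :: "complex mat"
  assumes "A \<in> carrier_mat k k" "D \<in> carrier_mat l l"
  shows "mat_adjoint (four_block_mat A (0\<^sub>m k l) (0\<^sub>m l k) D)
       = four_block_mat (mat_adjoint A) (0\<^sub>m k l) (0\<^sub>m l k) (mat_adjoint D)"
  by (rule eq_matI) (use assms in auto)

lemma four_block_diag_mult:
  fixes A D A' D' :: "complex mat"
  assumes "A \<in> carrier_mat k k" "D \<in> carrier_mat l l" "A' \<in> carrier_mat k k" "D' \<in> carrier_mat l l"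
  shows "four_block_mat A (0\<^sub>m k l) (0\<^sub>m l k) D * four_block_mat A' (0\<^sub>m k l) (0\<^sub>m l k) D'
       = four_block_mat (A * A') (0\<^sub>m k l) (0\<^sub>m l k) (D * D')"
  by (subst mult_four_block_mat[of _ k k _ l _ l _ _ k _ l]) (use assms in auto)

text \<open>The first row is the conjugate of the first column, so it vanishes off the diagonal as well.\<close>

lemma hermitian_deflate:
  fixes A :: "complex mat"
  assumes A: "A \<in> carrier_mat (Suc k) (Suc k)" and h: "mat_adjoint A = A"
    and col: "\<And>i. i < Suc k \<Longrightarrow> A $$ (i, 0) = (if i = 0 then e else 0)"
  obtains D where "D \<in> carrier_mat k k" "mat_adjoint D = D"
    "A = four_block_mat (e \<cdot>\<^sub>m 1\<^sub>m 1) (0\<^sub>m 1 k) (0\<^sub>m k 1) D"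
proof
  let ?D = "mat k k (\<lambda>(i, j). A $$ (Suc i, Suc j))"
  have sym: "A $$ (i, j) = cnj (A $$ (j, i))" if "i < Suc k" "j < Suc k" for i j
  proof -
    have "A $$ (i, j) = mat_adjoint A $$ (i, j)" by (simp add: h)
    also have "\<dots> = cnj (A $$ (j, i))" using A that by simp
    finally show ?thesis .
  qed
  show "?D \<in> carrier_mat k k" by simp
  show "mat_adjoint ?D = ?D"
  proof (rule eq_matI)
    fix i j assume "i < dim_row ?D" "j < dim_col ?D"
    then show "mat_adjoint ?D $$ (i, j) = ?D $$ (i, j)"
      using sym[of "Suc i" "Suc j"] by simp
  qed auto
  show "A = four_block_mat (e \<cdot>\<^sub>m 1\<^sub>m 1) (0\<^sub>m 1 k) (0\<^sub>m k 1) ?D"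
  proof (rule eq_matI)
    fix i j assume "i < dim_row (four_block_mat (e \<cdot>\<^sub>m 1\<^sub>m 1) (0\<^sub>m 1 k) (0\<^sub>m k 1) ?D)"
      "j < dim_col (four_block_mat (e \<cdot>\<^sub>m 1\<^sub>m 1) (0\<^sub>m 1 k) (0\<^sub>m k 1) ?D)"
    then have ij: "i < Suc k" "j < Suc k" by auto
    then show "A $$ (i, j) = four_block_mat (e \<cdot>\<^sub>m 1\<^sub>m 1) (0\<^sub>m 1 k) (0\<^sub>m k 1) ?D $$ (i, j)"
      using col[of i] col[of j] sym[of i j] by (cases i; cases j) auto
  qed (use A in auto)
qed

text \<open>The spectral theorem, by deflation: conjugating with a unitary matrix whose first column is an
  eigenvector to \<open>e\<close> puts \<open>e\<close> in the corner, and the characteristic polynomial of the remaining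
  block is the quotient by the factor of \<open>e\<close>. The order of the eigenvalues on the diagonal can
  therefore be prescribed; below, this lets the diagonal be increasing without any permutation of
  columns.\<close>

lemma hermitian_diagonalisation:
  fixes A :: "complex mat"
  assumes "A \<in> carrier_mat n n" "mat_adjoint A = A" "char_poly A = (\<Prod>e\<leftarrow>es. [:- e, 1:])"
  shows "\<exists>U. unitary_mat n U \<and> A = U * mat_diag n ((!) es) * mat_adjoint U"
  using assms
proof (induction es arbitrary: n A)
  case Nil
  then have "n = 0" using degree_monic_char_poly[of A n] by simp
  then show ?case using Nil by (intro exI[of _ "1\<^sub>m 0"]) (auto simp: unitary_mat_def)
next
  case (Cons e es)
  note A [simp] = Cons.prems(1)
  have eig: "eigenvalue A e"
    unfolding eigenvalue_root_char_poly[OF A] using Cons.prems(3) by simp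
  then obtain v where v: "v \<in> carrier_vec n" "v \<noteq> 0\<^sub>v n" "A *\<^sub>v v = e \<cdot>\<^sub>v v"
    using A by (auto simp: eigenvalue_def eigenvector_def)
  have "n \<noteq> 0" using v(1,2) by (intro notI) (auto simp: vec_eq_iff)
  then obtain k where n: "n = Suc k" by (cases n) auto
  then have n0: "0 < n" by simp
  obtain W c where W: "unitary_mat n W" and W0: "col W 0 = c \<cdot>\<^sub>v v"
    using unitary_first_column[OF v(1,2)] by blast
  have Wc [simp]: "W \<in> carrier_mat n n" using W by (simp add: unitary_mat_def)
  define A' where "A' = mat_adjoint W * A * W"
  have A'c: "A' \<in> carrier_mat n n" by (simp add: A'_def)
  have A'h: "mat_adjoint A' = A'"
    by (simp add: A'_def mat_adjoint_conj[of "mat_adjoint W" n A, simplified] Cons.prems(2))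
  have AA': "A = W * A' * mat_adjoint W"
    using unitary_conj_swap[OF W A] A'_def by simp
  have "A' $$ (i, 0) = (if i = 0 then e else 0)" if i: "i < Suc k" for i
  proof -
    have Av: "A *\<^sub>v col W 0 = e \<cdot>\<^sub>v col W 0"
      using v by (simp add: W0 mult_mat_vec[of _ n n] smult_smult_assoc mult.commute)
    have "col A' 0 = mat_adjoint W *\<^sub>v (A *\<^sub>v col W 0)"
      using n0 by (simp add: A'_def assoc_mult_mat[of _ n n _ n _ n] col_mult2[of _ n n _ n])
    also have "\<dots> = e \<cdot>\<^sub>v (mat_adjoint W *\<^sub>v col W 0)"
      using n0 by (simp add: Av mult_mat_vec[of _ n n])
    also have "mat_adjoint W *\<^sub>v col W 0 = col (mat_adjoint W * W) 0"
      using n0 by (simp add: col_mult2[of _ n n _ n])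
    also have "mat_adjoint W * W = 1\<^sub>m n" using W by (simp add: unitary_mat_def)
    finally have "col A' 0 $ i = (e \<cdot>\<^sub>v col (1\<^sub>m n) 0) $ i" by simp
    then show ?thesis using i n A'c by auto
  qed
  then obtain D where D [simp]: "D \<in> carrier_mat k k" and Dh: "mat_adjoint D = D"
    and A'D: "A' = four_block_mat (e \<cdot>\<^sub>m 1\<^sub>m 1) (0\<^sub>m 1 k) (0\<^sub>m k 1) D"
    using hermitian_deflate[OF A'c[unfolded n] A'h] by metis
  have "[:- e, 1:] * (\<Prod>e\<leftarrow>es. [:- e, 1:]) = char_poly A'"
    using Cons.prems(3) char_poly_unitary_conj[OF W A'c] AA' by simp
  also have "\<dots> = char_poly (e \<cdot>\<^sub>m 1\<^sub>m 1) * char_poly D"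
    unfolding A'D by (rule char_poly_four_block_zeros_col) auto
  also have "char_poly (e \<cdot>\<^sub>m 1\<^sub>m 1) = [:- e, 1:]"
    by (simp add: char_poly_defs det_def sign_def)
  finally have "char_poly D = (\<Prod>e\<leftarrow>es. [:- e, 1:])"
    by (metis mult_cancel_left pCons_eq_0_iff zero_neq_one)
  from Cons.IH[OF D Dh this] obtain U where U: "unitary_mat k U"
    and DU: "D = U * mat_diag k ((!) es) * mat_adjoint U" by blast
  have Uc [simp]: "U \<in> carrier_mat k k" using U by (simp add: unitary_mat_def)
  let ?blk = "\<lambda>X Y. four_block_mat X (0\<^sub>m 1 k) (0\<^sub>m k 1) Y"
  define U' where "U' = ?blk (1\<^sub>m 1) U"
  have U'c [simp]: "U' \<in> carrier_mat n n" using four_block_carrier_mat[of "1\<^sub>m 1" 1 1 U k k] by (simp add: U'_def n)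
  have U'adj: "mat_adjoint U' = ?blk (1\<^sub>m 1) (mat_adjoint U)"
    unfolding U'_def by (subst four_block_diag_adjoint) auto
  have one: "?blk (1\<^sub>m 1) (1\<^sub>m k) = 1\<^sub>m n"
    by (rule eq_matI) (auto simp: n)
  have U': "unitary_mat n U'"
  proof (rule unitary_matI[OF U'c])
    have "mat_adjoint U' * U' = ?blk (1\<^sub>m 1 * 1\<^sub>m 1) (mat_adjoint U * U)"
      unfolding U'adj unfolding U'_def by (rule four_block_diag_mult) auto
    then show "mat_adjoint U' * U' = 1\<^sub>m n"
      using U one by (simp add: unitary_mat_def)
  qed
  have diag: "mat_diag n ((!) (e # es)) = ?blk (e \<cdot>\<^sub>m 1\<^sub>m 1) (mat_diag k ((!) es))"
    by (rule eq_matI) (auto simp: n mat_diag_def nth_Cons')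
  have "U' * mat_diag n ((!) (e # es)) * mat_adjoint U'
      = ?blk (1\<^sub>m 1 * (e \<cdot>\<^sub>m 1\<^sub>m 1)) (U * mat_diag k ((!) es)) * mat_adjoint U'"
    unfolding diag unfolding U'_def by (subst four_block_diag_mult) auto
  also have "\<dots> = ?blk (1\<^sub>m 1 * (e \<cdot>\<^sub>m 1\<^sub>m 1) * 1\<^sub>m 1) (U * mat_diag k ((!) es) * mat_adjoint U)"
    unfolding U'adj by (rule four_block_diag_mult) auto
  also have "\<dots> = A'"
    unfolding A'D DU by simp
  finally have "A' = U' * mat_diag n ((!) (e # es)) * mat_adjoint U'" ..
  then have "A = (W * U') * mat_diag n ((!) (e # es)) * mat_adjoint (W * U')"
    unfolding AA' by (simp add: mat_adjoint_mult[of W n n U' n] assoc_mult_mat[of _ n n _ n _ n])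
  then show ?case using unitary_mat_mult[OF W U'] by blast
qed

lemma mult_mat_vec_index:
  assumes "A \<in> carrier_mat n k" "v \<in> carrier_vec k" "i < n"
  shows "(A *\<^sub>v v) $ i = (\<Sum>j<k. A $$ (i, j) * v $ j)"
  using assms by (auto simp: scalar_prod_def atLeast0LessThan intro!: sum.cong)

section \<open>Functions of a Hermitian matrix\<close>

lemma unitary_diag_mult:
  assumes U: "unitary_mat n U"
  shows "(U * mat_diag n f * mat_adjoint U) * (U * mat_diag n g * mat_adjoint U)
       = U * mat_diag n (\<lambda>i. f i * g i) * mat_adjoint U"
proof -
  have [simp]: "U \<in> carrier_mat n n" using U by (simp add: unitary_mat_def)
  have "(U * mat_diag n f * mat_adjoint U) * (U * mat_diag n g * mat_adjoint U)
      = U * (mat_diag n f * (mat_adjoint U * U) * mat_diag n g) * mat_adjoint U"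
    by (simp add: assoc_mult_mat[of _ n n _ n _ n])
  also have "mat_adjoint U * U = 1\<^sub>m n" using U by (simp add: unitary_mat_def)
  finally show ?thesis by (simp add: right_mult_one_mat[of _ n n])
qed

lemma unitary_diag_form:
  assumes U: "unitary_mat n U" and v: "v \<in> carrier_vec n"
  shows "Re (((U * mat_diag n (\<lambda>i. complex_of_real (d i)) * mat_adjoint U) *\<^sub>v v) \<bullet>c v)
       = (\<Sum>i<n. d i * (cmod ((mat_adjoint U *\<^sub>v v) $ i))\<^sup>2)"
proof -
  have [simp]: "U \<in> carrier_mat n n" using U by (simp add: unitary_mat_def)
  let ?D = "mat_diag n (\<lambda>i. complex_of_real (d i))"
  define w where "w = mat_adjoint U *\<^sub>v v"
  have w [simp]: "w \<in> carrier_vec n" using v by (simp add: w_def)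
  have "((U * ?D * mat_adjoint U) *\<^sub>v v) = U *\<^sub>v (?D *\<^sub>v w)"
    using v by (simp add: w_def assoc_mult_mat_vec[of _ n n _ n])
  also have "\<dots> \<bullet>c v = (?D *\<^sub>v w) \<bullet>c w"
    unfolding w_def using v by (intro cscalar_prod_adjoint[of _ n n]) auto
  also have "?D *\<^sub>v w = vec n (\<lambda>i. complex_of_real (d i) * w $ i)"
  proof (rule eq_vecI)
    fix i assume "i < dim_vec (vec n (\<lambda>i. complex_of_real (d i) * w $ i))"
    then have i: "i < n" by simp
    have "(?D *\<^sub>v w) $ i = (\<Sum>j<n. ?D $$ (i, j) * w $ j)"
      by (rule mult_mat_vec_index[OF mat_diag_dim w i])
    also have "\<dots> = (\<Sum>j<n. if j = i then complex_of_real (d i) * w $ i else 0)"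
      using i by (intro sum.cong) (auto simp: mat_diag_def)
    also have "\<dots> = vec n (\<lambda>i. complex_of_real (d i) * w $ i) $ i"
      using i by simp
    finally show "(?D *\<^sub>v w) $ i = vec n (\<lambda>i. complex_of_real (d i) * w $ i) $ i" .
  qed (simp add: mat_diag_def)
  also have "\<dots> \<bullet>c w = (\<Sum>i<n. complex_of_real (d i * (cmod (w $ i))\<^sup>2))"
    using w by (auto simp: scalar_prod_def atLeast0LessThan complex_norm_square mult.assoc
        simp del: of_real_power intro!: sum.cong)
  finally show ?thesis by (simp add: w_def)
qed

lemma unitary_diag_hermitian:
  assumes U: "unitary_mat n U"
  shows "mat_adjoint (U * mat_diag n (\<lambda>i. complex_of_real (d i)) * mat_adjoint U)
       = U * mat_diag n (\<lambda>i. complex_of_real (d i)) * mat_adjoint U"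
  using U by (subst mat_adjoint_conj[of _ n]) (auto simp: unitary_mat_def mat_adjoint_mat_diag)

text \<open>The diagonal matrix is unitarily similar to \<open>A\<close>, hence itself Hermitian.\<close>

lemma hermitian_real_spectrum:
  fixes A :: "complex mat"
  assumes A: "A \<in> carrier_mat n n" and h: "mat_adjoint A = A"
    and c: "char_poly A = (\<Prod>e\<leftarrow>es. [:- e, 1:])" and e: "e \<in> set es"
  shows "e \<in> \<real>"
proof -
  obtain U where U: "unitary_mat n U" and AU: "A = U * mat_diag n ((!) es) * mat_adjoint U"
    using hermitian_diagonalisation[OF A h c] by blast
  have [simp]: "U \<in> carrier_mat n n" using U by (simp add: unitary_mat_def)
  have "mat_diag n ((!) es) = mat_adjoint U * A * U"
    using unitary_conj_swap[OF unitary_mat_adjoint[OF U], of "mat_diag n ((!) es)" A] AU by simp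
  then have "mat_adjoint (mat_diag n ((!) es)) = mat_diag n ((!) es)"
    using mat_adjoint_conj[of "mat_adjoint U" n A] A h by simp
  moreover have "length es = n"
    using degree_monic_char_poly[OF A] c degree_linear_factors[of uminus es] by simp
  then obtain i where i: "i < n" "e = es ! i" using e by (auto simp: in_set_conv_nth)
  ultimately have "mat_diag n (\<lambda>i. cnj (es ! i)) $$ (i, i) = mat_diag n ((!) es) $$ (i, i)"
    unfolding mat_adjoint_mat_diag by simp
  then show ?thesis using i by (simp add: mat_diag_def Reals_cnj_iff)
qed

text \<open>Once the roots of the characteristic polynomial are known to be real they can be sorted, and the
  diagonalisation is applied a second time with the sorted list.\<close>

lemma hermitian_spectral:
  assumes A: "A \<in> carrier_mat n n" and h: "mat_adjoint A = A"
  obtains U d where "unitary_mat n U"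
    "A = U * mat_diag n (\<lambda>i. complex_of_real (d i)) * mat_adjoint U"
    "\<And>i j. i \<le> j \<Longrightarrow> j < n \<Longrightarrow> d i \<le> d j"
    "\<And>k. nth_eigenvalue A k = d (k - 1)"
proof -
  obtain as where c: "char_poly A = (\<Prod>a\<leftarrow>as. [:- a, 1:])" and len: "length as = n"
    using char_poly_factorized[OF A] by blast
  define rs where "rs = sort (map Re as)"
  have as: "map (complex_of_real \<circ> Re) as = as"
    using hermitian_real_spectrum[OF A h c] by (intro map_idI) auto
  have "mset (map complex_of_real rs) = mset (map (complex_of_real \<circ> Re) as)"
    unfolding rs_def by (simp add: multiset.map_comp)
  then have "mset (map complex_of_real rs) = mset as" unfolding as .
  then have "mset (map (\<lambda>a. [:- a, 1:]) (map complex_of_real rs)) = mset (map (\<lambda>a. [:- a, 1:]) as)"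
    by (metis mset_map)
  then have c': "char_poly A = (\<Prod>a\<leftarrow>map complex_of_real rs. [:- a, 1:])"
    unfolding c by (metis prod_mset_prod_list)
  obtain U where U: "unitary_mat n U"
    and AU: "A = U * mat_diag n ((!) (map complex_of_real rs)) * mat_adjoint U"
    using hermitian_diagonalisation[OF A h c'] by blast
  have lr: "length rs = n" by (simp add: rs_def len)
  have D: "mat_diag n ((!) (map complex_of_real rs)) = mat_diag n (\<lambda>i. complex_of_real (rs ! i))"
    by (rule eq_matI) (auto simp: mat_diag_def lr)
  have roots: "proots (\<Prod>a\<leftarrow>as. [:- a, 1:]) = mset as"
    by (induction as) (simp_all add: proots_mult prod_list_zero_iff image_iff del: mult_pCons_left)
  have ev: "nth_eigenvalue A k = rs ! (k - 1)" for k
    unfolding nth_eigenvalue_def c rs_def roots by (simp flip: mset_map)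
  show ?thesis
  proof (rule that[OF U AU[unfolded D]])
    show "rs ! i \<le> rs ! j" if "i \<le> j" "j < n" for i j
      using that lr by (simp add: rs_def sorted_nth_mono)
  qed (rule ev)
qed

section \<open>Positive semidefinite square roots\<close>

lemma psd_mat_iff:
  assumes "A \<in> carrier_mat n n"
  shows "psd_mat A \<longleftrightarrow> mat_adjoint A = A \<and> (\<forall>v \<in> carrier_vec n. 0 \<le> Re ((A *\<^sub>v v) \<bullet>c v))"
  using assms by (auto simp: psd_mat_def hermitian_mat_def)

lemma psd_unitary_diag:
  assumes U: "unitary_mat n U" and d: "\<And>i. i < n \<Longrightarrow> 0 \<le> d i"
  shows "psd_mat (U * mat_diag n (\<lambda>i. complex_of_real (d i)) * mat_adjoint U)"
proof -
  have [simp]: "U \<in> carrier_mat n n" using U by (simp add: unitary_mat_def)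
  show ?thesis
    by (subst psd_mat_iff[of _ n])
       (auto simp: unitary_diag_hermitian[OF U] unitary_diag_form[OF U] d intro!: sum_nonneg)
qed

lemma unitary_column_adjoint:
  assumes U: "unitary_mat n U" and i: "i < n"
  shows "mat_adjoint U *\<^sub>v col U i = unit_vec n i"
proof -
  have [simp]: "U \<in> carrier_mat n n" using U by (simp add: unitary_mat_def)
  have "mat_adjoint U *\<^sub>v col U i = col (mat_adjoint U * U) i"
    using i by (simp add: col_mult2[of _ n n _ n])
  then show ?thesis using U i by (simp add: unitary_mat_def)
qed

lemma unitary_diag_form_column:
  assumes U: "unitary_mat n U" and i: "i < n"
  shows "Re (((U * mat_diag n (\<lambda>i. complex_of_real (d i)) * mat_adjoint U) *\<^sub>v col U i) \<bullet>c col U i)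
       = d i"
proof -
  have "col U i \<in> carrier_vec n" using U by (auto simp: unitary_mat_def)
  then have "Re (((U * mat_diag n (\<lambda>i. complex_of_real (d i)) * mat_adjoint U) *\<^sub>v col U i) \<bullet>c col U i)
      = (\<Sum>j<n. if j = i then d i else 0)"
    unfolding unitary_diag_form[OF U \<open>col U i \<in> carrier_vec n\<close>] unitary_column_adjoint[OF U i]
    by (intro sum.cong) (use i in auto)
  then show ?thesis using i by simp
qed

lemma psd_root_exists:
  assumes A: "A \<in> carrier_mat n n" and psd: "psd_mat A"
  shows "\<exists>B \<in> carrier_mat n n. psd_mat B \<and> B * B = A"
proof -
  have h: "mat_adjoint A = A" and pos: "\<And>v. v \<in> carrier_vec n \<Longrightarrow> 0 \<le> Re ((A *\<^sub>v v) \<bullet>c v)"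
    using psd psd_mat_iff[OF A] by auto
  obtain U d where U: "unitary_mat n U"
    and AU: "A = U * mat_diag n (\<lambda>i. complex_of_real (d i)) * mat_adjoint U"
    by (rule hermitian_spectral[OF A h])
  have Uc [simp]: "U \<in> carrier_mat n n" using U by (simp add: unitary_mat_def)
  have d: "0 \<le> d i" if "i < n" for i
    using unitary_diag_form_column[OF U that, of d] pos[of "col U i"] that carrier_matD[OF Uc]
      col_dim[of U i] unfolding AU[symmetric] by simp
  let ?B = "U * mat_diag n (\<lambda>i. complex_of_real (sqrt (d i))) * mat_adjoint U"
  have "mat_diag n (\<lambda>i. complex_of_real (sqrt (d i)) * complex_of_real (sqrt (d i)))
      = mat_diag n (\<lambda>i. complex_of_real (d i))"
    by (rule eq_matI) (auto simp: mat_diag_def d simp flip: of_real_mult)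
  then have "?B * ?B = A" by (simp add: unitary_diag_mult[OF U] AU)
  moreover have "psd_mat ?B" using d by (intro psd_unitary_diag U) auto
  ultimately show ?thesis by (intro bexI[of _ ?B]) auto
qed

lemma norm_add_scaled:
  fixes w u :: "complex vec"
  assumes w: "w \<in> carrier_vec n" and u: "u \<in> carrier_vec n"
  shows "Re ((w + complex_of_real t \<cdot>\<^sub>v u) \<bullet>c (w + complex_of_real t \<cdot>\<^sub>v u))
       = Re (w \<bullet>c w) + 2 * t * Re (w \<bullet>c u) + t\<^sup>2 * Re (u \<bullet>c u)"
proof -
  have "Re ((x + of_real t * y) * cnj (x + of_real t * y))
      = Re (x * cnj x) + 2 * t * Re (x * cnj y) + t\<^sup>2 * Re (y * cnj y)" for x y
    by (simp add: power2_eq_square algebra_simps)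
  then show ?thesis
    using w u by (simp add: scalar_prod_def atLeast0LessThan sum.distrib sum_distrib_left
        del: complex_cnj_add complex_cnj_mult times_complex.simps)
qed

text \<open>The argument looks at an eigenvector \<open>u\<close> of the Hermitian matrix \<open>B - C\<close>, with eigenvalue \<open>t\<close>.
  From \<open>B\<^sup>2 = C\<^sup>2\<close> the vectors \<open>B u\<close> and \<open>C u = B u - t u\<close> have the same length. Expanding this in
  the two possible ways shows that \<open>t \<noteq> 0\<close> would give both \<open>t = 2 \<langle>B u, u\<rangle> \<ge> 0\<close> and
  \<open>t = -2 \<langle>C u, u\<rangle> \<le> 0\<close>. So all eigenvalues of \<open>B - C\<close> vanish.\<close>

lemma psd_root_unique:
  assumes B: "B \<in> carrier_mat n n" "psd_mat B" and C: "C \<in> carrier_mat n n" "psd_mat C"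
    and sq: "B * B = C * C"
  shows "B = C"
proof -
  note [simp] = B(1) C(1)
  have hB: "mat_adjoint B = B" and pB: "\<And>v. v \<in> carrier_vec n \<Longrightarrow> 0 \<le> Re ((B *\<^sub>v v) \<bullet>c v)"
    using B psd_mat_iff[OF B(1)] by auto
  have hC: "mat_adjoint C = C" and pC: "\<And>v. v \<in> carrier_vec n \<Longrightarrow> 0 \<le> Re ((C *\<^sub>v v) \<bullet>c v)"
    using C psd_mat_iff[OF C(1)] by auto
  have "B - C \<in> carrier_mat n n" "mat_adjoint (B - C) = B - C"
    using minus_carrier_mat[OF C(1), of B] by (simp_all add: mat_adjoint_minus[of _ n n] hB hC)
  then obtain U d where U: "unitary_mat n U"
    and DU: "B - C = U * mat_diag n (\<lambda>i. complex_of_real (d i)) * mat_adjoint U"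
    by (rule hermitian_spectral)
  have Uc [simp]: "U \<in> carrier_mat n n" using U by (simp add: unitary_mat_def)
  have "d i = 0" if i: "i < n" for i
  proof -
    define u where "u = col U i"
    define t where "t = d i"
    have u [simp]: "u \<in> carrier_vec n" using Uc i by (auto simp: u_def)
    have Uu1: "mat_adjoint U *\<^sub>v u = unit_vec n i"
      using unitary_column_adjoint[OF U i] by (simp add: u_def)
    have Uu2: "U *\<^sub>v unit_vec n i = u"
      unfolding Uu1[symmetric] using U
      by (simp add: unitary_mat_def assoc_mult_mat_vec[of _ n n _ n, symmetric])
    have "(B - C) *\<^sub>v u = U *\<^sub>v (mat_diag n (\<lambda>i. complex_of_real (d i)) *\<^sub>v unit_vec n i)"
      unfolding DU Uu1[symmetric] by (simp add: assoc_mult_mat_vec[of _ n n _ n])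
    also have "mat_diag n (\<lambda>i. complex_of_real (d i)) *\<^sub>v unit_vec n i = complex_of_real t \<cdot>\<^sub>v unit_vec n i"
      by (rule eq_vecI) (auto simp: mat_diag_def t_def i)
    also have "U *\<^sub>v (complex_of_real t \<cdot>\<^sub>v unit_vec n i) = complex_of_real t \<cdot>\<^sub>v u"
      by (simp add: mult_mat_vec[of _ n n] Uu2)
    finally have Du: "(B - C) *\<^sub>v u = complex_of_real t \<cdot>\<^sub>v u" .
    have Dv: "B *\<^sub>v u - C *\<^sub>v u = complex_of_real t \<cdot>\<^sub>v u"
      unfolding Du[symmetric] by (simp add: minus_mult_distrib_mat_vec[of _ n n])
    have Bu: "B *\<^sub>v u = C *\<^sub>v u + complex_of_real t \<cdot>\<^sub>v u"
      unfolding Dv[symmetric] by (rule eq_vecI) (auto simp: carrier_matD[OF B(1)] carrier_matD[OF C(1)])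
    have Cu: "C *\<^sub>v u = B *\<^sub>v u + complex_of_real (- t) \<cdot>\<^sub>v u"
      unfolding Bu by (rule eq_vecI) (auto simp: carrier_vecD[OF u] carrier_matD[OF C(1)])
    have form: "(X *\<^sub>v u) \<bullet>c (X *\<^sub>v u) = ((X * X) *\<^sub>v u) \<bullet>c u"
      if "X \<in> carrier_mat n n" "mat_adjoint X = X" for X
      using that cscalar_prod_adjoint[of X n n "X *\<^sub>v u" u] by (simp add: assoc_mult_mat_vec[of _ n n _ n])
    have eq: "(B *\<^sub>v u) \<bullet>c (B *\<^sub>v u) = (C *\<^sub>v u) \<bullet>c (C *\<^sub>v u)"
      using sq by (simp add: form hB hC)
    have uu: "Re (u \<bullet>c u) = 1"
    proof -
      have "(\<Sum>j<n. (cmod (u $ j))\<^sup>2) = (\<Sum>j<n. (cmod (unit_vec n i $ j))\<^sup>2)"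
        using unitary_norm[OF U, of "unit_vec n i"] by (simp add: Uu2)
      also have "\<dots> = (\<Sum>j<n. if j = i then 1 else 0)"
        using i by (intro sum.cong) auto
      finally show ?thesis using i by (simp add: cscalar_prod_self[OF u] del: of_real_sum)
    qed
    have 1: "2 * t * Re ((C *\<^sub>v u) \<bullet>c u) + t\<^sup>2 = 0"
      using norm_add_scaled[of "C *\<^sub>v u" n u t] eq uu unfolding Bu[symmetric] by simp
    have 2: "- 2 * t * Re ((B *\<^sub>v u) \<bullet>c u) + t\<^sup>2 = 0"
      using norm_add_scaled[of "B *\<^sub>v u" n u "- t"] eq uu unfolding Cu[symmetric] by simp
    have "t * (2 * Re ((C *\<^sub>v u) \<bullet>c u) + t) = 0" "t * (t - 2 * Re ((B *\<^sub>v u) \<bullet>c u)) = 0"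
      using 1 2 by (simp_all only: power2_eq_square) (simp_all add: algebra_simps)
    then have "t = 0"
      using pB[OF u] pC[OF u] unfolding mult_eq_0_iff by linarith
    then show ?thesis by (simp add: t_def)
  qed
  then have "mat_diag n (\<lambda>i. complex_of_real (d i)) = 0\<^sub>m n n"
    by (intro eq_matI) (auto simp: mat_diag_def)
  then have "B - C = 0\<^sub>m n n"
    unfolding DU by (simp add: left_mult_zero_mat[of _ n n] right_mult_zero_mat[of _ n n])
  then have z: "(B - C) $$ (i, j) = 0" if "i < n" "j < n" for i j using that by simp
  show ?thesis
    by (rule eq_matI) (use z in \<open>auto simp: carrier_matD[OF B(1)] carrier_matD[OF C(1)]\<close>)
qed

lemma psd_sqrtI:
  assumes "B \<in> carrier_mat n n" "psd_mat B"
  shows "psd_sqrt (B * B) = B"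
  unfolding psd_sqrt_def using assms
  by (intro the_equality) (auto intro: psd_root_unique[of _ n])

lemma psd_sqrt:
  assumes A: "A \<in> carrier_mat n n" and psd: "psd_mat A"
  shows "psd_sqrt A \<in> carrier_mat n n" "psd_mat (psd_sqrt A)" "psd_sqrt A * psd_sqrt A = A"
  using psd_root_exists[OF A psd] psd_sqrtI by auto

lemma psd_adjoint_mult:
  assumes A: "A \<in> carrier_mat n k"
  shows "psd_mat (mat_adjoint A * A)"
proof -
  have c: "mat_adjoint A * A \<in> carrier_mat k k" using A by auto
  have "Re ((mat_adjoint A * A *\<^sub>v v) \<bullet>c v) \<ge> 0" if v: "v \<in> carrier_vec k" for v
  proof -
    have Av: "A *\<^sub>v v \<in> carrier_vec n" using A v by auto
    have "(mat_adjoint A * A *\<^sub>v v) = mat_adjoint A *\<^sub>v (A *\<^sub>v v)"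
      using A v by (intro assoc_mult_mat_vec[of _ k n _ k]) auto
    also have "\<dots> \<bullet>c v = (A *\<^sub>v v) \<bullet>c (A *\<^sub>v v)"
      using A v Av cscalar_prod_adjoint[of "mat_adjoint A" k n "A *\<^sub>v v" v] by simp
    finally show ?thesis by (simp add: cscalar_prod_self[OF Av] sum_nonneg del: of_real_sum)
  qed
  moreover have "mat_adjoint (mat_adjoint A * A) = mat_adjoint A * A"
    using A by (subst mat_adjoint_mult[of _ k n _ k]) auto
  ultimately show ?thesis by (simp add: psd_mat_iff[OF c])
qed

text \<open>In an orthonormal eigenbasis of \<open>H\<close> the absolute value replaces every eigenvalue by its modulus,
  so both quadratic forms are sums over the same squared coordinates.\<close>

lemma mat_abs_bounds:
  assumes H: "H \<in> carrier_mat n n" "mat_adjoint H = H"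
  shows "mat_abs H \<in> carrier_mat n n" "mat_adjoint (mat_abs H) = mat_abs H"
    and "v \<in> carrier_vec n \<Longrightarrow> \<bar>Re ((H *\<^sub>v v) \<bullet>c v)\<bar> \<le> Re ((mat_abs H *\<^sub>v v) \<bullet>c v)"
proof -
  obtain U d where U: "unitary_mat n U"
    and HU: "H = U * mat_diag n (\<lambda>i. complex_of_real (d i)) * mat_adjoint U"
    by (rule hermitian_spectral[OF H])
  have [simp]: "U \<in> carrier_mat n n" using U by (simp add: unitary_mat_def)
  let ?B = "U * mat_diag n (\<lambda>i. complex_of_real \<bar>d i\<bar>) * mat_adjoint U"
  have "psd_mat ?B" by (intro psd_unitary_diag U) auto
  moreover have "?B * ?B = H * H"
    unfolding HU unitary_diag_mult[OF U] by (simp flip: of_real_mult)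
  ultimately have B: "mat_abs H = ?B"
    using psd_sqrtI[of ?B n] by (simp add: mat_abs_def H(2))
  show "mat_abs H \<in> carrier_mat n n" "mat_adjoint (mat_abs H) = mat_abs H"
    by (simp_all add: B unitary_diag_hermitian[OF U])
  assume v: "v \<in> carrier_vec n"
  show "\<bar>Re ((H *\<^sub>v v) \<bullet>c v)\<bar> \<le> Re ((mat_abs H *\<^sub>v v) \<bullet>c v)"
    unfolding B unfolding HU unitary_diag_form[OF U v]
    by (rule order_trans[OF sum_abs]) (simp add: abs_mult)
qed

section \<open>Monotonicity of eigenvalues\<close>

text \<open>Weyl's monotonicity principle, by the dimension count of Courant and Fischer. The span of the
  first \<open>l\<close> eigenvectors of \<open>B\<close> contains a vector \<open>v \<noteq> 0\<close> orthogonal to the first \<open>l - 1\<close>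
  eigenvectors of \<open>A\<close>, and at \<open>v\<close> the form of \<open>A\<close> is at least the \<open>l\<close>-th eigenvalue of \<open>A\<close>, the form
  of \<open>B\<close> at most the \<open>l\<close>-th eigenvalue of \<open>B\<close>, times the squared length of \<open>v\<close>.\<close>

lemma nth_eigenvalue_mono:
  assumes A: "A \<in> carrier_mat n n" "mat_adjoint A = A"
    and B: "B \<in> carrier_mat n n" "mat_adjoint B = B"
    and le: "\<And>v. v \<in> carrier_vec n \<Longrightarrow> Re ((A *\<^sub>v v) \<bullet>c v) \<le> Re ((B *\<^sub>v v) \<bullet>c v)"
    and l: "1 \<le> l" "l \<le> n"
  shows "nth_eigenvalue A l \<le> nth_eigenvalue B l"
proof -
  obtain U \<alpha> where U: "unitary_mat n U"
    and AU: "A = U * mat_diag n (\<lambda>i. complex_of_real (\<alpha> i)) * mat_adjoint U"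
    and \<alpha>: "\<And>i j. i \<le> j \<Longrightarrow> j < n \<Longrightarrow> \<alpha> i \<le> \<alpha> j"
    and A_l: "\<And>k. nth_eigenvalue A k = \<alpha> (k - 1)"
    using hermitian_spectral[OF A] by blast
  obtain V \<beta> where V: "unitary_mat n V"
    and BV: "B = V * mat_diag n (\<lambda>i. complex_of_real (\<beta> i)) * mat_adjoint V"
    and \<beta>: "\<And>i j. i \<le> j \<Longrightarrow> j < n \<Longrightarrow> \<beta> i \<le> \<beta> j"
    and B_l: "\<And>k. nth_eigenvalue B k = \<beta> (k - 1)"
    using hermitian_spectral[OF B] by blast
  have [simp]: "U \<in> carrier_mat n n" "V \<in> carrier_mat n n"
    using U V by (simp_all add: unitary_mat_def)
  obtain k where k: "l = Suc k" "k < n" using l by (cases l) auto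
  define W where "W = mat_adjoint U * V"
  have W: "unitary_mat n W"
    unfolding W_def by (intro unitary_mat_mult unitary_mat_adjoint U V)
  have Wc [simp]: "W \<in> carrier_mat n n" by (simp add: W_def)
  \<comment> \<open>The \<open>l - 1\<close> orthogonality conditions on \<open>l\<close> coefficients, made square by a zero row: the
    determinant vanishes, so there is a nontrivial solution.\<close>
  define M where "M = mat\<^sub>r l l (\<lambda>j. if j = k then 0\<^sub>v l else vec l (\<lambda>i. W $$ (j, i)))"
  have M: "M \<in> carrier_mat l l" by (rule carrier_matI) (simp_all add: M_def)
  have "det M = 0" unfolding M_def using k by (intro det_row_0) auto
  then obtain c where c: "c \<in> carrier_vec l" "c \<noteq> 0\<^sub>v l" "M *\<^sub>v c = 0\<^sub>v l"
    using det_0_iff_vec_prod_zero[OF M] by blast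
  \<comment> \<open>\<open>y\<close> are the coordinates of \<open>v\<close> in the eigenbasis of \<open>B\<close>; those in the eigenbasis of \<open>A\<close>
    are \<open>W y\<close>.\<close>
  define y where "y = vec n (\<lambda>i. if i < l then c $ i else 0)"
  have y [simp]: "y \<in> carrier_vec n" by (simp add: y_def)
  define v where "v = V *\<^sub>v y"
  have v [simp]: "v \<in> carrier_vec n" by (simp add: v_def)
  have Vv: "mat_adjoint V *\<^sub>v v = y"
    using V by (simp add: v_def unitary_mat_def assoc_mult_mat_vec[of _ n n _ n, symmetric])
  have Uv: "mat_adjoint U *\<^sub>v v = W *\<^sub>v y"
    by (simp add: v_def W_def assoc_mult_mat_vec[of _ n n _ n])
  have Wy: "(W *\<^sub>v y) $ j = 0" if "j < k" for j
  proof -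
    have "(W *\<^sub>v y) $ j = (\<Sum>i<n. W $$ (j, i) * y $ i)"
      using that k by (intro mult_mat_vec_index[OF Wc y]) simp
    also have "\<dots> = (\<Sum>i<l. W $$ (j, i) * c $ i)"
      using k l by (intro sum.mono_neutral_cong_right) (auto simp: y_def)
    also have "\<dots> = (\<Sum>i<l. M $$ (j, i) * c $ i)"
      using that k by (intro sum.cong) (auto simp: M_def)
    also have "\<dots> = (M *\<^sub>v c) $ j"
      using that k by (intro mult_mat_vec_index[OF M c(1), symmetric]) simp
    finally show ?thesis using c(3) that k by simp
  qed
  define s where "s = (\<Sum>i<n. (cmod (y $ i))\<^sup>2)"
  obtain i where i: "i < l" "c $ i \<noteq> 0"
    using c(1,2) by (metis carrier_vecD eq_vecI index_zero_vec)
  have "(cmod (y $ i))\<^sup>2 \<le> s"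
    unfolding s_def using i l by (intro member_le_sum) auto
  moreover have "0 < (cmod (y $ i))\<^sup>2" using i l by (simp add: y_def)
  ultimately have s: "0 < s" by linarith
  have "\<alpha> k * s = (\<Sum>j<n. \<alpha> k * (cmod ((W *\<^sub>v y) $ j))\<^sup>2)"
    by (simp add: s_def unitary_norm[OF W y, symmetric] sum_distrib_left)
  also have "\<dots> \<le> (\<Sum>j<n. \<alpha> j * (cmod ((W *\<^sub>v y) $ j))\<^sup>2)"
  proof (rule sum_mono)
    fix j assume "j \<in> {..<n}"
    then show "\<alpha> k * (cmod ((W *\<^sub>v y) $ j))\<^sup>2 \<le> \<alpha> j * (cmod ((W *\<^sub>v y) $ j))\<^sup>2"
      using Wy[of j] \<alpha>[of k j] by (cases "j < k") (auto intro: mult_right_mono)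
  qed
  also have "\<dots> = Re ((A *\<^sub>v v) \<bullet>c v)"
    unfolding AU unitary_diag_form[OF U v] Uv ..
  also have "\<dots> \<le> Re ((B *\<^sub>v v) \<bullet>c v)" by (rule le) simp
  also have "\<dots> = (\<Sum>j<n. \<beta> j * (cmod (y $ j))\<^sup>2)"
    unfolding BV unitary_diag_form[OF V v] Vv ..
  also have "\<dots> \<le> (\<Sum>j<n. \<beta> k * (cmod (y $ j))\<^sup>2)"
  proof (rule sum_mono)
    fix j assume "j \<in> {..<n}"
    then show "\<beta> j * (cmod (y $ j))\<^sup>2 \<le> \<beta> k * (cmod (y $ j))\<^sup>2"
      using \<beta>[of j k] k by (cases "j < l") (auto simp: y_def intro: mult_right_mono)
  qed
  also have "\<dots> = \<beta> k * s" by (simp add: s_def sum_distrib_left)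
  finally show ?thesis using s A_l[of l] B_l[of l] k by simp
qed

lemma form_add:
  fixes A B :: "complex mat"
  assumes "A \<in> carrier_mat n n" "B \<in> carrier_mat n n" "v \<in> carrier_vec n"
  shows "Re (((A + B) *\<^sub>v v) \<bullet>c v) = Re ((A *\<^sub>v v) \<bullet>c v) + Re ((B *\<^sub>v v) \<bullet>c v)"
proof -
  have c: "A *\<^sub>v v \<in> carrier_vec n" "B *\<^sub>v v \<in> carrier_vec n" "conjugate v \<in> carrier_vec n"
    using assms by simp_all
  show ?thesis
    unfolding add_mult_distrib_mat_vec[OF assms] add_scalar_prod_distrib[OF c] by simp
qed

lemma form_minus:
  fixes A B :: "complex mat"
  assumes "A \<in> carrier_mat n n" "B \<in> carrier_mat n n" "v \<in> carrier_vec n"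
  shows "Re (((A - B) *\<^sub>v v) \<bullet>c v) = Re ((A *\<^sub>v v) \<bullet>c v) - Re ((B *\<^sub>v v) \<bullet>c v)"
proof -
  have c: "A *\<^sub>v v \<in> carrier_vec n" "B *\<^sub>v v \<in> carrier_vec n" "conjugate v \<in> carrier_vec n"
    using assms by simp_all
  show ?thesis
    unfolding minus_mult_distrib_mat_vec[OF assms] minus_scalar_prod_distrib[OF c] by simp
qed

text \<open>Adding a Hermitian \<open>T\<close> changes the quadratic form by at most that of \<open>|T|\<close>, in either
  direction.\<close>

lemma nth_eigenvalue_perturbation:
  assumes H: "H \<in> carrier_mat n n" "mat_adjoint H = H"
    and T: "T \<in> carrier_mat n n" "mat_adjoint T = T"
    and l: "1 \<le> l" "l \<le> n"
  shows "nth_eigenvalue (H - mat_abs T) l \<le> nth_eigenvalue (H + T) l"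
    and "nth_eigenvalue (H + T) l \<le> nth_eigenvalue (H + mat_abs T) l"
proof -
  note abs = mat_abs_bounds[OF T]
  have herm: "mat_adjoint (H - mat_abs T) = H - mat_abs T"
    "mat_adjoint (H + T) = H + T" "mat_adjoint (H + mat_abs T) = H + mat_abs T"
    by (simp_all only: mat_adjoint_add[OF H(1) T(1)] mat_adjoint_add[OF H(1) abs(1)]
        mat_adjoint_minus[OF H(1) abs(1)] H(2) T(2) abs(2))
  have carr: "H - mat_abs T \<in> carrier_mat n n" "H + T \<in> carrier_mat n n"
    "H + mat_abs T \<in> carrier_mat n n"
    by (auto simp: minus_carrier_mat[OF abs(1)] add_carrier_mat[OF abs(1)] add_carrier_mat[OF T(1)])
  show "nth_eigenvalue (H - mat_abs T) l \<le> nth_eigenvalue (H + T) l"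
  proof (rule nth_eigenvalue_mono[OF carr(1) herm(1) carr(2) herm(2) _ l])
    fix v :: "complex vec" assume v: "v \<in> carrier_vec n"
    show "Re (((H - mat_abs T) *\<^sub>v v) \<bullet>c v) \<le> Re (((H + T) *\<^sub>v v) \<bullet>c v)"
      using abs(3)[OF v] unfolding form_add[OF H(1) T(1) v] form_minus[OF H(1) abs(1) v] by linarith
  qed
  show "nth_eigenvalue (H + T) l \<le> nth_eigenvalue (H + mat_abs T) l"
  proof (rule nth_eigenvalue_mono[OF carr(2) herm(2) carr(3) herm(3) _ l])
    fix v :: "complex vec" assume v: "v \<in> carrier_vec n"
    show "Re (((H + T) *\<^sub>v v) \<bullet>c v) \<le> Re (((H + mat_abs T) *\<^sub>v v) \<bullet>c v)"
      using abs(3)[OF v] unfolding form_add[OF H(1) T(1) v] form_add[OF H(1) abs(1) v] by linarith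
  qed
qed

section \<open>Block matrices\<close>

lemma block_matrix_carrier [simp]: "block_matrix p m B \<in> carrier_mat (p * m) (p * m)"
  by (simp add: block_matrix_def)

lemma block_index:
  fixes m p r :: nat
  assumes "r < p * m"
  shows "r div m + 1 \<in> {1..p}" "r mod m < m"
proof -
  have "0 < m" using assms by (cases m) auto
  then show "r div m + 1 \<in> {1..p}" "r mod m < m"
    using assms by (auto simp: less_mult_imp_div_less Suc_leI)
qed

lemma block_matrix_cong:
  assumes "\<And>i j. i \<in> {1..p} \<Longrightarrow> j \<in> {1..p} \<Longrightarrow> B i j = C i j"
  shows "block_matrix p m B = block_matrix p m C"
  by (rule eq_matI) (auto simp: block_matrix_def assms[OF block_index(1) block_index(1)] simp del: One_nat_def)

lemma block_matrix_adjoint: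
  assumes "\<And>i j. i \<in> {1..p} \<Longrightarrow> j \<in> {1..p} \<Longrightarrow> B i j \<in> carrier_mat m m"
  shows "mat_adjoint (block_matrix p m B) = block_matrix p m (\<lambda>i j. mat_adjoint (B j i))"
proof (rule eq_matI)
  fix r c assume "r < dim_row (block_matrix p m (\<lambda>i j. mat_adjoint (B j i)))"
    "c < dim_col (block_matrix p m (\<lambda>i j. mat_adjoint (B j i)))"
  then have rc: "r < p * m" "c < p * m" by (auto simp: block_matrix_def)
  have "B (c div m + 1) (r div m + 1) \<in> carrier_mat m m"
    using rc by (intro assms block_index)
  then show "mat_adjoint (block_matrix p m B) $$ (r, c) = block_matrix p m (\<lambda>i j. mat_adjoint (B j i)) $$ (r, c)"
    using rc block_index(2)[OF rc(1)] block_index(2)[OF rc(2)] by (simp add: block_matrix_def)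
qed (auto simp: block_matrix_def)

text \<open>If row \<open>i\<close> of blocks of the left factor has its only possibly nonzero block in column \<open>\<sigma> i\<close>,
  then every block of the product is a product of two blocks. This covers block diagonal matrices
  (\<open>\<sigma>\<close> the identity) as well as the corner matrix \<open>K\<^sub>1(x)\<close> (\<open>\<sigma>\<close> the exchange of \<open>1\<close> and \<open>p\<close>), and
  avoids sums of matrices.\<close>

lemma block_matrix_mult_monomial:
  assumes B: "\<And>i j. i \<in> {1..p} \<Longrightarrow> j \<in> {1..p} \<Longrightarrow> B i j \<in> carrier_mat m m"
    and C: "\<And>i j. i \<in> {1..p} \<Longrightarrow> j \<in> {1..p} \<Longrightarrow> C i j \<in> carrier_mat m m"
    and \<sigma>: "\<And>i. i \<in> {1..p} \<Longrightarrow> \<sigma> i \<in> {1..p}"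
    and z: "\<And>i j. i \<in> {1..p} \<Longrightarrow> j \<in> {1..p} \<Longrightarrow> j \<noteq> \<sigma> i \<Longrightarrow> B i j = 0\<^sub>m m m"
  shows "block_matrix p m B * block_matrix p m C = block_matrix p m (\<lambda>i j. B i (\<sigma> i) * C (\<sigma> i) j)"
proof (rule eq_matI)
  fix r c assume "r < dim_row (block_matrix p m (\<lambda>i j. B i (\<sigma> i) * C (\<sigma> i) j))"
    "c < dim_col (block_matrix p m (\<lambda>i j. B i (\<sigma> i) * C (\<sigma> i) j))"
  then have rc: "r < p * m" "c < p * m" by (auto simp: block_matrix_def)
  define i where "i = r div m + 1"
  define j where "j = c div m + 1"
  have i: "i \<in> {1..p}" and j: "j \<in> {1..p}" and rm: "r mod m < m" and cm: "c mod m < m"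
    using block_index[OF rc(1)] block_index[OF rc(2)] by (auto simp: i_def j_def)
  obtain q where q: "\<sigma> i = q + 1" "q < p" using \<sigma>[OF i] by (cases "\<sigma> i") auto
  let ?f = "\<lambda>t. B i (t div m + 1) $$ (r mod m, t mod m) * C (t div m + 1) j $$ (t mod m, c mod m)"
  have "(block_matrix p m B * block_matrix p m C) $$ (r, c) = (\<Sum>t<p * m. ?f t)"
    using rc by (auto simp: block_matrix_def scalar_prod_def atLeast0LessThan i_def j_def intro!: sum.cong)
  \<comment> \<open>Only the column indices of block \<open>\<sigma> i\<close> contribute.\<close>
  also have "\<dots> = (\<Sum>t \<in> (\<lambda>s. q * m + s) ` {..<m}. ?f t)"
  proof (rule sum.mono_neutral_right)
    have "q * m + s < p * m" if "s < m" for s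
    proof -
      have "q * m + s < (q + 1) * m" using that by simp
      also have "\<dots> \<le> p * m" using q by (intro mult_right_mono) auto
      finally show ?thesis .
    qed
    then show "(\<lambda>s. q * m + s) ` {..<m} \<subseteq> {..<p * m}" by auto
    show "\<forall>t \<in> {..<p * m} - (\<lambda>s. q * m + s) ` {..<m}. ?f t = 0"
    proof
      fix t assume t: "t \<in> {..<p * m} - (\<lambda>s. q * m + s) ` {..<m}"
      then have tm: "t < p * m" by simp
      have "t div m \<noteq> q"
      proof
        assume "t div m = q"
        then have "t = q * m + t mod m" by (metis div_mult_mod_eq)
        then show False using t block_index(2)[OF tm] by blast
      qed
      then have "B i (t div m + 1) = 0\<^sub>m m m"
        using block_index(1)[OF tm] q by (intro z i) auto
      then show "?f t = 0" using rm block_index(2)[OF tm] by simp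
    qed
  qed simp
  also have "\<dots> = (\<Sum>s<m. ?f (q * m + s))"
    by (subst sum.reindex) (auto simp: inj_on_def)
  also have "\<dots> = (\<Sum>s<m. B i (\<sigma> i) $$ (r mod m, s) * C (\<sigma> i) j $$ (s, c mod m))"
    by (intro sum.cong) (auto simp: q)
  also have "\<dots> = (B i (\<sigma> i) * C (\<sigma> i) j) $$ (r mod m, c mod m)"
    using B[OF i \<sigma>[OF i]] C[OF \<sigma>[OF i] j] rm cm
    by (auto simp: scalar_prod_def atLeast0LessThan intro!: sum.cong)
  finally show "(block_matrix p m B * block_matrix p m C) $$ (r, c)
      = block_matrix p m (\<lambda>i j. B i (\<sigma> i) * C (\<sigma> i) j) $$ (r, c)"
    using rc by (simp add: block_matrix_def i_def j_def)
qed (auto simp: block_matrix_def)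

definition corner_blocks :: "nat \<Rightarrow> nat \<Rightarrow> complex mat \<Rightarrow> complex mat \<Rightarrow> complex mat" where
  "corner_blocks p m P Q = block_matrix p m (\<lambda>i j.
     if i = 1 \<and> j = 1 then P else if i = p \<and> j = p then Q else 0\<^sub>m m m)"

lemma corner_blocks_adjoint:
  assumes "P \<in> carrier_mat m m" "Q \<in> carrier_mat m m"
  shows "mat_adjoint (corner_blocks p m P Q) = corner_blocks p m (mat_adjoint P) (mat_adjoint Q)"
  unfolding corner_blocks_def
  by (subst block_matrix_adjoint) (use assms in \<open>auto intro!: block_matrix_cong\<close>)

lemma corner_blocks_mult:
  assumes p: "2 \<le> p"
    and c: "P \<in> carrier_mat m m" "Q \<in> carrier_mat m m" "P' \<in> carrier_mat m m" "Q' \<in> carrier_mat m m"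
  shows "corner_blocks p m P Q * corner_blocks p m P' Q' = corner_blocks p m (P * P') (Q * Q')"
  unfolding corner_blocks_def
  by (subst block_matrix_mult_monomial[where \<sigma> = "\<lambda>i. i"])
     (use p c in \<open>auto intro!: block_matrix_cong\<close>)

text \<open>Positivity comes from a factorisation \<open>E\<^sup>* E\<close>, where \<open>E\<close> consists of the square roots of the
  corners, so that the quadratic form need not be split into blocks.\<close>

lemma psd_corner_blocks:
  assumes p: "2 \<le> p" and P: "P \<in> carrier_mat m m" "psd_mat P" and Q: "Q \<in> carrier_mat m m" "psd_mat Q"
  shows "psd_mat (corner_blocks p m P Q)"
proof -
  note P' = psd_sqrt[OF P] and Q' = psd_sqrt[OF Q]
  let ?E = "corner_blocks p m (psd_sqrt P) (psd_sqrt Q)"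
  have "mat_adjoint ?E = ?E"
    using P' Q' by (simp add: corner_blocks_adjoint psd_mat_def hermitian_mat_def)
  moreover have "?E * ?E = corner_blocks p m P Q"
    using p P' Q' by (simp add: corner_blocks_mult)
  moreover have "psd_mat (mat_adjoint ?E * ?E)"
    by (rule psd_adjoint_mult[of _ "p * m" "p * m"]) (simp add: corner_blocks_def)
  ultimately show ?thesis by simp
qed

section \<open>The matrices of the Floquet decomposition\<close>

lemma K1_carrier [simp]: "K1 p m a x \<in> carrier_mat (p * m) (p * m)"
  by (simp add: K1_def)

lemma K0_carrier [simp]: "K0 p m a b \<in> carrier_mat (p * m) (p * m)"
  by (simp add: K0_def)

lemma K0_hermitian:
  assumes a: "\<And>n. a n \<in> carrier_mat m m" and b: "\<And>n. b n \<in> carrier_mat m m"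
    and bh: "\<And>n. mat_adjoint (b n) = b n"
  shows "mat_adjoint (K0 p m a b) = K0 p m a b"
  unfolding K0_def by (subst block_matrix_adjoint) (auto simp: a b bh intro!: block_matrix_cong)

lemma K1_hermitian:
  assumes p: "2 \<le> p" and a: "a 0 \<in> carrier_mat m m"
  shows "mat_adjoint (K1 p m a x) = K1 p m a x"
proof -
  have "cnj (exp (\<i> * complex_of_real x)) = exp (- (\<i> * complex_of_real x))"
    using cis_cnj[of x] by (simp add: cis_conv_exp)
  moreover from this have "cnj (exp (- (\<i> * complex_of_real x))) = exp (\<i> * complex_of_real x)"
    by (metis complex_cnj_cnj)
  ultimately show ?thesis
    unfolding K1_def
    by (subst block_matrix_adjoint)
       (use p a in \<open>auto simp: mat_adjoint_smult intro!: block_matrix_cong\<close>)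
qed

lemma smult_mult_smult:
  fixes A B :: "complex mat"
  assumes "A \<in> carrier_mat n k" "B \<in> carrier_mat k l"
  shows "c \<cdot>\<^sub>m A * (d \<cdot>\<^sub>m B) = (c * d) \<cdot>\<^sub>m (A * B)"
  by (rule eq_matI) (use assms in \<open>auto simp: scalar_prod_def sum_distrib_left mult_ac\<close>)

text \<open>The two phases cancel, which is why \<open>|K\<^sub>1(x)|\<close> does not depend on \<open>x\<close>.\<close>

lemma K1_square:
  assumes p: "2 \<le> p" and a: "a 0 \<in> carrier_mat m m"
  shows "K1 p m a x * K1 p m a x = corner_blocks p m (mat_adjoint (a 0) * a 0) (a 0 * mat_adjoint (a 0))"
proof -
  have u: "exp (\<i> * complex_of_real x) * exp (- (\<i> * complex_of_real x)) = 1"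
    by (simp flip: exp_add)
  have one: "1 \<cdot>\<^sub>m X = X" for X :: "complex mat" by (rule eq_matI) auto
  have prods: "exp (- (\<i> * complex_of_real x)) \<cdot>\<^sub>m mat_adjoint (a 0) * (exp (\<i> * complex_of_real x) \<cdot>\<^sub>m a 0)
      = mat_adjoint (a 0) * a 0"
    "exp (\<i> * complex_of_real x) \<cdot>\<^sub>m a 0 * (exp (- (\<i> * complex_of_real x)) \<cdot>\<^sub>m mat_adjoint (a 0))
      = a 0 * mat_adjoint (a 0)"
    using u a by (simp_all add: smult_mult_smult[of _ m m _ m] mult.commute one)
  show ?thesis
    unfolding K1_def corner_blocks_def
    by (subst block_matrix_mult_monomial[where \<sigma> = "\<lambda>i. if i = 1 then p else if i = p then 1 else i"])
       (use p a in \<open>auto simp: prods intro!: block_matrix_cong\<close>)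
qed

text \<open>The matrix on the right is positive semidefinite and has the required square, so uniqueness of
  the square root identifies it with the absolute value.\<close>

lemma mat_abs_K1:
  assumes p: "2 \<le> p" and a: "a 0 \<in> carrier_mat m m"
  shows "mat_abs (K1 p m a x)
       = corner_blocks p m (psd_sqrt (mat_adjoint (a 0) * a 0)) (psd_sqrt (a 0 * mat_adjoint (a 0)))"
proof -
  have a': "mat_adjoint (a 0) \<in> carrier_mat m m" using a by simp
  note P = psd_sqrt[OF square_mult_carrier[OF a' a] psd_adjoint_mult[OF a]]
  have "psd_mat (a 0 * mat_adjoint (a 0))" using psd_adjoint_mult[OF a'] by simp
  note Q = psd_sqrt[OF square_mult_carrier[OF a a'] this]
  let ?D = "corner_blocks p m (psd_sqrt (mat_adjoint (a 0) * a 0)) (psd_sqrt (a 0 * mat_adjoint (a 0)))"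
  have "K1 p m a x * mat_adjoint (K1 p m a x) = ?D * ?D"
    using p a P Q by (simp add: K1_hermitian K1_square corner_blocks_mult)
  moreover have "psd_sqrt (?D * ?D) = ?D"
    using p P Q by (intro psd_sqrtI[of _ "p * m"] psd_corner_blocks) (auto simp: corner_blocks_def)
  ultimately show ?thesis by (simp add: mat_abs_def)
qed

theorem mainTheorem2:
  fixes m p :: nat
    and a b :: "int \<Rightarrow> complex mat"
    and J :: "(int \<Rightarrow> complex Matrix.vec) \<Rightarrow> (int \<Rightarrow> complex Matrix.vec)"
  assumes "1 \<le> m" and "3 \<le> p"
    and "\<And>n. a n \<in> carrier_mat m m" and "\<And>n. b n \<in> carrier_mat m m"
    and "\<And>n. mat_adjoint (b n) = b n"
    and "\<And>n. a (n + int p) = a n" and "\<And>n. b (n + int p) = b n"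
    and "\<And>y. y \<in> ell2 m \<Longrightarrow> J y = jacobi_op a b y"
    and "\<And>n. Re (mat_trace (psd_sqrt (a 0 * mat_adjoint (a 0))))
              \<le> Re (mat_trace (psd_sqrt (a n * mat_adjoint (a n))))"
  shows "(\<forall>x \<in> {0..2 * pi}. mat_abs (K1 p m a x) = block_matrix p m (\<lambda>i j.
              if i = 1 \<and> j = 1 then psd_sqrt (mat_adjoint (a 0) * a 0)
              else if i = p \<and> j = p then psd_sqrt (a 0 * mat_adjoint (a 0))
              else 0\<^sub>m m m))
       \<and> (\<forall>n \<in> {1..p * m}. \<forall>x \<in> {0..2 * pi}.
              nth_eigenvalue (K0 p m a b - mat_abs (K1 p m a x)) n \<le> nth_eigenvalue (K p m a b x) n
            \<and> nth_eigenvalue (K p m a b x) n \<le> nth_eigenvalue (K0 p m a b + mat_abs (K1 p m a x)) n)"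
proof -
  have p: "2 \<le> p" using \<open>3 \<le> p\<close> by simp
  have K0h: "mat_adjoint (K0 p m a b) = K0 p m a b"
    by (rule K0_hermitian) (fact assms)+
  have K1h: "mat_adjoint (K1 p m a x) = K1 p m a x" for x
    by (rule K1_hermitian[where a = a, OF p assms(3)])
  have abs: "mat_abs (K1 p m a x) = block_matrix p m (\<lambda>i j.
              if i = 1 \<and> j = 1 then psd_sqrt (mat_adjoint (a 0) * a 0)
              else if i = p \<and> j = p then psd_sqrt (a 0 * mat_adjoint (a 0))
              else 0\<^sub>m m m)" for x
    using mat_abs_K1[where a = a, OF p assms(3)] unfolding corner_blocks_def .
  have bounds: "nth_eigenvalue (K0 p m a b - mat_abs (K1 p m a x)) n \<le> nth_eigenvalue (K p m a b x) n
            \<and> nth_eigenvalue (K p m a b x) n \<le> nth_eigenvalue (K0 p m a b + mat_abs (K1 p m a x)) n"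
    if "n \<in> {1..p * m}" for n x
  proof -
    have n: "1 \<le> n" "n \<le> p * m" using that by auto
    show ?thesis
      unfolding K_def
      using nth_eigenvalue_perturbation[OF K0_carrier K0h K1_carrier K1h n] by (rule conjI)
  qed
  show ?thesis
    by (intro conjI ballI abs bounds[THEN conjunct1] bounds[THEN conjunct2])
qed

end
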